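(* There exists an odd primitive singular number.
   Context: A finite set $S$ of positive integers is GCD closed if $\gcd(a,b)\in S$ for all $a,b\in S$. For a GCD closed set $S$, $\mu_S$ denotes the Möbius function of the poset $(S,\mid)$ ($S$ ordered by divisibility): $\mu_S(u,u)=1$, $\mu_S(u,v)=-\sum_{w\in S,\ u\mid w\mid v,\ w\ne v}\mu_S(u,w)$ if $u\mid v$, $u\neq v$, and $\mu_S(u,v)=0$ if $u\nmid v$. For $x\in S$ define $$\Psi_{S,\frac1N}(x)=\sum_{y\in S,\ y\mid x}\frac{\mu_S(y,x)}{y}.$$ A positive integer $x$ is a singular number if there exists a GCD closed set $S=\{x_1,\ldots,x_n\}$ with $1\le x_1<\cdots<x_n=x$ such that $\Psi_{S,\frac1N}(x)=0$; otherwise $x$ is a nonsingular number. A positive integer $x$ is a primitive singular number if $x$ is singular and every positive divisor $x'$ of $x$ with $x'\ne x$ is nonsingular. *)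

theory Defs
  imports Complex_Main
begin

definition gcd_closed :: "nat set \<Rightarrow> bool" where
  "gcd_closed S \<longleftrightarrow>
     finite S \<and> (\<forall>a\<in>S. 0 < a) \<and> (\<forall>a\<in>S. \<forall>b\<in>S. gcd a b \<in> S)"

text \<open>
  The Moebius function of the poset \<open>(S, dvd)\<close>; only the values at \<open>u, v \<in> S\<close> are meaningful.
  Proper divisors of \<open>v\<close> are smaller than \<open>v\<close> except when \<open>v = 0\<close>, which has to be placed
  on top in the termination order.
\<close>

function moebius_on :: "nat set \<Rightarrow> nat \<Rightarrow> nat \<Rightarrow> int" where
  "moebius_on S u v =
     (if u = v then 1
      else if u dvd v then - (\<Sum>w\<in>{w \<in> S. u dvd w \<and> w dvd v \<and> w \<noteq> v}. moebius_on S u w)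
      else 0)"
  by auto
termination
proof (relation "measures [\<lambda>(S, u, v). of_bool (v = 0), \<lambda>(S, u, v). v]", goal_cases)
  case 1 then show ?case by simp
next
  case (2 S u v w)
  then have "w dvd v" "w \<noteq> v" by blast+
  then show ?case by (cases "v = 0") (auto dest: dvd_imp_le)
qed

declare moebius_on.simps [simp del]

definition Psi_inv :: "nat set \<Rightarrow> nat \<Rightarrow> rat" where
  "Psi_inv S x = (\<Sum>y\<in>{y \<in> S. y dvd x}. of_int (moebius_on S y x) / of_nat y)"

definition singular_number :: "nat \<Rightarrow> bool" where
  "singular_number x \<longleftrightarrow>
     0 < x \<and> (\<exists>S. gcd_closed S \<and> x \<in> S \<and> (\<forall>y\<in>S. y \<le> x) \<and> Psi_inv S x = 0)"

definition nonsingular_number :: "nat \<Rightarrow> bool" where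
  "nonsingular_number x \<longleftrightarrow> 0 < x \<and> \<not> singular_number x"

definition primitive_singular_number :: "nat \<Rightarrow> bool" where
  "primitive_singular_number x \<longleftrightarrow>
     singular_number x \<and> (\<forall>d. d dvd x \<and> d \<noteq> x \<longrightarrow> nonsingular_number d)"

end

theory Submission
  imports Defs
begin

text \<open>
  The number 1020180525 = lcm (195, 291, 1407, 4025) is singular: in the GCD closed set below
  it covers 195, 291, 1407 and 4025, and the sum defining \<open>\<Psi>\<close> reads
  1/1020180525 - 1/195 - 1/291 - 1/1407 - 1/4025 + 2/3 + 1/5 + 1/7 - 1 = 0.
  Its least singular divisor is then an odd primitive singular number.
\<close>

definition odd_singular_set :: "nat set" where
  "odd_singular_set = set [1, 3, 5, 7, 195, 291, 1407, 4025, 1020180525]"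

lemma gcd_closed_odd_singular_set: "gcd_closed odd_singular_set"
  unfolding gcd_closed_def odd_singular_set_def by (simp add: gcd_non_0_nat)

text \<open>Lets \<open>simp\<close> evaluate these sums by filtering an explicit list; distinctness
  makes each element count once.\<close>

lemma sum_odd_singular_set:
  "(\<Sum>y\<in>{y \<in> odd_singular_set. P y}. f y) =
    (\<Sum>y\<leftarrow>filter P [1, 3, 5, 7, 195, 291, 1407, 4025, 1020180525]. f y)"
proof -
  have "{y \<in> odd_singular_set. P y} =
      set (filter P [1, 3, 5, 7, 195, 291, 1407, 4025, 1020180525])"
    by (simp only: odd_singular_set_def set_filter)
  moreover have "distinct (filter P [1, 3, 5, 7, 195, 291, 1407, 4025, 1020180525])"
    by (rule distinct_filter) simp
  ultimately show ?thesis
    by (simp only: sum_list_distinct_conv_sum_set)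
qed

lemma moebius_on_same: "moebius_on S u u = 1"
  by (subst moebius_on.simps) simp

lemma moebius_on_proper_dvd:
  assumes "u dvd v" "u \<noteq> v"
  shows "moebius_on S u v =
    - (\<Sum>w\<in>{w \<in> S. u dvd w \<and> w dvd v \<and> w \<noteq> v}. moebius_on S u w)"
  by (subst moebius_on.simps) (use assms in simp)

text \<open>Only covered elements lie strictly between 3, 5 or 7 and the top, so the value there is
  their number minus 1: three lie above 3, two above each of 5 and 7.\<close>

lemma moebius_on_odd_singular_set:
  defines "m \<equiv> \<lambda>y. moebius_on odd_singular_set y 1020180525"
  shows "m 1020180525 = 1" "m 4025 = -1" "m 1407 = -1" "m 291 = -1" "m 195 = -1"
    "m 7 = 1" "m 5 = 1" "m 3 = 2" "m 1 = -1"
  unfolding m_def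
  by (simp_all add: moebius_on_same moebius_on_proper_dvd sum_odd_singular_set)

lemma Psi_inv_odd_singular_set: "Psi_inv odd_singular_set 1020180525 = 0"
  unfolding Psi_inv_def
  by (simp add: sum_odd_singular_set moebius_on_odd_singular_set
      \<comment> \<open>\<open>simp\<close> turns the argument 1 into \<open>Suc 0\<close>, so the
        value at 1 is also supplied in that form.\<close>
      moebius_on_odd_singular_set(9)[unfolded One_nat_def])

lemma singular_number_1020180525: "singular_number 1020180525"
  unfolding singular_number_def
  using gcd_closed_odd_singular_set Psi_inv_odd_singular_set
  by (intro conjI exI[of _ odd_singular_set]) (auto simp: odd_singular_set_def)

text \<open>A proper divisor of the least singular divisor of \<open>n\<close> is a smaller divisor
  of \<open>n\<close>, so minimality makes it nonsingular.\<close>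

lemma primitive_singular_divisor:
  assumes "singular_number n"
  obtains x where "x dvd n" "primitive_singular_number x"
proof -
  define x where "x = (LEAST d. d dvd n \<and> singular_number d)"
  have x: "x dvd n" "singular_number x"
    using LeastI[of "\<lambda>d. d dvd n \<and> singular_number d" n] assms by (simp_all add: x_def)
  have "nonsingular_number d" if "d dvd x" "d \<noteq> x" for d
  proof -
    have "0 < x"
      using x by (simp add: singular_number_def)
    with that have "0 < d" "d < x"
      by (auto simp: dvd_imp_le intro!: Nat.gr0I le_neq_implies_less)
    moreover have "d dvd n"
      using that x dvd_trans by blast
    ultimately show ?thesis
      using not_less_Least[of d "\<lambda>d. d dvd n \<and> singular_number d"]
      by (auto simp: nonsingular_number_def x_def)
  qed
  with x that show ?thesis
    by (auto simp: primitive_singular_number_def)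
qed

theorem corollary4p1:
  shows "\<exists>x. odd x \<and> primitive_singular_number x"
proof -
  obtain x where "x dvd 1020180525" "primitive_singular_number x"
    using primitive_singular_divisor[OF singular_number_1020180525] .
  moreover have "odd (1020180525 :: nat)"
    by simp
  ultimately show ?thesis
    \<comment> \<open>If 2 divided \<open>x\<close>, it would divide 1020180525.\<close>
    using dvd_trans by blast
qed

end
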